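(* For each $n\ge 2$ let $X=X^{(n)}$ be an arbitrary random variable with values in $\{2,\dots,n\}$, and consider the $X$-Block Average process on $n$ sites started from a Dirac mass. Then for every fixed $\varepsilon\in(0,1)$, $$t_{\rm mix}(\varepsilon)\asymp t_{\rm ent}\qquad\text{as } n\to\infty,\qquad\text{where } t_{\rm ent}=\frac{n\log n}{\mathbb E[X\log X]},$$ that is, both ratios $t_{\rm mix}(\varepsilon)/t_{\rm ent}$ and $t_{\rm ent}/t_{\rm mix}(\varepsilon)$ stay bounded as $n\to\infty$.
   Context: Let $V=\{1,\dots,n\}$ and let $\Delta$ be the set of probability vectors on $V$. For $A\subset V$ and $\eta\in\Delta$, let $\varPsi_A\eta(x)=\frac1{|A|}\sum_{y\in A}\eta(y)$ if $x\in A$ and $\varPsi_A\eta(x)=\eta(x)$ if $x\notin A$. Given the law of $X$ (which may depend on $n$), let $X_1,X_2,\dots$ be i.i.d. copies of $X$ and, independently for each $t$, given $X_t$ let $A_t$ be a uniformly random subset of $V$ with $|A_t|=X_t$. The $X$-Block Average process started from $\eta_0$ is $\eta_t=\varPsi_{A_t}\cdots\varPsi_{A_1}\eta_0$; here $\eta_0$ is the Dirac mass at some $x_0\in V$. Let $\pi(x)\equiv 1/n$, $\|v\|_{\rm TV}=\frac12\sum_{x\in V}|v(x)|$, $d_{\rm TV}(t)=\|\eta_t-\pi\|_{\rm TV}$ (a random variable), and $t_{\rm mix}(\varepsilon)=\inf\{t\in\mathbb N:\ \mathbb E[d_{\rm TV}(t)]<\varepsilon\}$. Logarithms are natural. *)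

theory Defs
  imports "HOL-Probability.Probability"
begin

text \<open>Sites are \<open>{1..n}\<close>; a vector on the sites is a function \<open>nat \<Rightarrow> real\<close>,
  of which only the values on \<open>{1..n}\<close> matter.\<close>

definition block_avg :: "nat set \<Rightarrow> (nat \<Rightarrow> real) \<Rightarrow> nat \<Rightarrow> real" where
  "block_avg A \<eta> x = (if x \<in> A then (1 / real (card A)) * (\<Sum>y\<in>A. \<eta> y) else \<eta> x)"

definition tv_norm :: "nat \<Rightarrow> (nat \<Rightarrow> real) \<Rightarrow> real" where
  "tv_norm n v = (1 / 2) * (\<Sum>x\<in>{1..n}. \<bar>v x\<bar>)"

definition dirac_mass :: "nat \<Rightarrow> nat \<Rightarrow> real" where
  "dirac_mass x0 = (\<lambda>x. if x = x0 then 1 else 0)"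

definition block_pmf :: "nat \<Rightarrow> nat pmf \<Rightarrow> (nat \<times> nat set) pmf" where
  "block_pmf n p = bind_pmf p (\<lambda>k. map_pmf (Pair k) (pmf_of_set {S. S \<subseteq> {1..n} \<and> card S = k}))"

text \<open>The law \<open>p\<close> is that of $X$. The pairs $(X_t, A_t)$, $t \ge 1$, are i.i.d., which encodes both
  that the $X_t$ are i.i.d. and that each $A_t$ is drawn, independently for each $t$, given $X_t$.
  The values at $t = 0$ are unconstrained and unused.\<close>

locale block_average = prob_space M
  for M :: "'a measure" +
  fixes n :: nat and p :: "nat pmf"
    and X :: "nat \<Rightarrow> 'a \<Rightarrow> nat" and A :: "nat \<Rightarrow> 'a \<Rightarrow> nat set"
  assumes block_subset: "\<And>t \<omega>. t \<ge> 1 \<Longrightarrow> \<omega> \<in> space M \<Longrightarrow> A t \<omega> \<subseteq> {1..n}"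
    and indep: "indep_vars (\<lambda>_. count_space UNIV) (\<lambda>t \<omega>. (X t \<omega>, A t \<omega>)) {1..}"
    and law: "\<And>t. t \<ge> 1 \<Longrightarrow>
      distr M (count_space UNIV) (\<lambda>\<omega>. (X t \<omega>, A t \<omega>)) = measure_pmf (block_pmf n p)"

primrec eta :: "(nat \<Rightarrow> 'a \<Rightarrow> nat set) \<Rightarrow> (nat \<Rightarrow> real) \<Rightarrow> nat \<Rightarrow> 'a \<Rightarrow> nat \<Rightarrow> real" where
  "eta A \<eta>0 0 \<omega> = \<eta>0"
| "eta A \<eta>0 (Suc t) \<omega> = block_avg (A (Suc t) \<omega>) (eta A \<eta>0 t \<omega>)"

definition d_TV :: "nat \<Rightarrow> (nat \<Rightarrow> 'a \<Rightarrow> nat set) \<Rightarrow> nat \<Rightarrow> nat \<Rightarrow> 'a \<Rightarrow> real" where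
  "d_TV n A x0 t \<omega> = tv_norm n (\<lambda>x. eta A (dirac_mass x0) t \<omega> x - 1 / real n)"

text \<open>Valued in \<^typ>\<open>enat\<close>, so that the infimum of the empty set is \<open>\<infinity>\<close> (on \<^typ>\<open>nat\<close> it
  would be \<open>0\<close>).\<close>

definition t_mix :: "'a measure \<Rightarrow> nat \<Rightarrow> (nat \<Rightarrow> 'a \<Rightarrow> nat set) \<Rightarrow> nat \<Rightarrow> real \<Rightarrow> enat" where
  "t_mix M n A x0 \<epsilon> = (INF t\<in>{t. (\<integral>\<omega>. d_TV n A x0 t \<omega> \<partial>M) < \<epsilon>}. enat t)"

definition t_ent :: "nat \<Rightarrow> nat pmf \<Rightarrow> real" where
  "t_ent n p = real n * ln (real n) / measure_pmf.expectation p (\<lambda>k. real k * ln (real k))"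

end

theory Submission
  imports Defs
begin

text \<open>Lower bound: averaging over a block \<open>B\<close> lowers the relative entropy of \<open>\<eta>\<close> by at most
  \<open>\<eta>(B) ln |B|\<close>, which has mean \<open>E[X ln X] / n\<close>. The entropy starts at \<open>ln n\<close>, and is at most
  \<open>(ln n + 1)\<close> times the total variation distance.

  Upper bound: \<open>\<eta>\<^sub>t\<close> is the law of a walker who, given the blocks, jumps to a uniform point of each
  block that contains him. An exponential moment bound shows that after a large multiple of \<open>t_ent\<close>
  steps the sizes of the blocks met by the walker have product at least \<open>n\<^sup>2\<close> with probability close
  to \<open>1\<close>. The \<open>L\<^sup>2\<close> norm of the sub-probability \<open>g\<close> carried by such trajectories is computed with two
  walkers using the same blocks: as long as they stay together, each block of size \<open>k\<close> costs a factor
  \<open>1 / k\<close>, so this case contributes at most \<open>1 / n\<^sup>2\<close>, and once separated they meet with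
  probability at most \<open>1 / n\<close>. Hence \<open>n E[\<Sum> g\<^sup>2]\<close> is at most \<open>1 + 1 / n\<close>, which together with total
  mass close to \<open>1\<close> forces \<open>g\<close> to be close to uniform.\<close>

section \<open>Block averages and walks\<close>

text \<open>As a matrix, averaging over \<open>B\<close> is symmetric: the part of either side
  carried by \<open>B\<close> is the product of the sums of \<open>v\<close> and \<open>u\<close>
  over \<open>B\<close>, divided by \<open>card B\<close>.\<close>

lemma block_avg_symmetric:
  assumes "finite V" "B \<subseteq> V"
  shows "(\<Sum>x\<in>V. block_avg B v x * u x) = (\<Sum>x\<in>V. v x * block_avg B u x)"
proof -
  have split: "(\<Sum>x\<in>V. f x) = (\<Sum>x\<in>B. f x) + (\<Sum>x\<in>V - B. f x)" for f :: "nat \<Rightarrow> real"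
    using assms by (metis sum.subset_diff add.commute)
  have "(\<Sum>x\<in>B. block_avg B v x * u x) = (\<Sum>x\<in>B. v x * block_avg B u x)"
    by (simp add: block_avg_def flip: sum_divide_distrib sum_distrib_left sum_distrib_right)
  moreover have "(\<Sum>x\<in>V - B. block_avg B v x * u x) = (\<Sum>x\<in>V - B. v x * block_avg B u x)"
    by (simp add: block_avg_def)
  ultimately show ?thesis by (simp add: split)
qed

lemma block_avg_const: "finite B \<Longrightarrow> block_avg B (\<lambda>_. c) x = c"
  by (auto simp: block_avg_def)

lemma block_avg_mono:
  assumes "\<And>y. y \<in> insert x B \<Longrightarrow> u y \<le> v y"
  shows "block_avg B u x \<le> block_avg B v x"
  using assms by (auto simp: block_avg_def intro!: divide_right_mono sum_mono)

lemma block_avg_cong: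
  assumes "\<And>y. y \<in> insert x B \<Longrightarrow> u y = v y"
  shows "block_avg B u x = block_avg B v x"
  using assms by (auto simp: block_avg_def)

lemma block_avg_diff: "block_avg B (\<lambda>y. u y - v y) x = block_avg B u x - block_avg B v x"
  by (simp add: block_avg_def sum_subtractf diff_divide_distrib)

lemma block_avg_mult_right: "block_avg B u x * c = block_avg B (\<lambda>y. u y * c) x"
  by (simp add: block_avg_def sum_distrib_right)

lemma block_avg_mult_left: "c * block_avg B u x = block_avg B (\<lambda>y. c * u y) x"
  by (simp add: block_avg_def sum_distrib_left)

text \<open>Given the block, two walkers jump independently, so second moments become iterated
  averages.\<close>

lemma block_avg_mult:
  "block_avg B u x * block_avg B v y = block_avg B (\<lambda>u'. block_avg B (\<lambda>v'. u u' * v v') y) x"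
  unfolding block_avg_mult_right unfolding block_avg_mult_left ..

text \<open>Two independent uniform points of \<open>B\<close> coincide with probability
  \<open>1 / card B\<close>. A walker outside \<open>B\<close> stays put, so unless both are in
  \<open>B\<close> they coincide only if \<open>x = x'\<close>.\<close>

lemma block_avg_block_avg_diagonal:
  assumes "finite B" "x \<notin> B \<or> B \<noteq> {}"
  shows "block_avg B (\<lambda>u. block_avg B (\<lambda>u'. a + (if u = u' then c else 0)) x') x =
    a + c * (if x \<in> B \<and> x' \<in> B then 1 / card B else if x = x' then 1 else 0)"
  using assms by (auto simp: block_avg_def sum.distrib sum.delta sum.delta' card_gt_0_iff field_simps)

lemma sum_block_avg:
  assumes "finite V" "B \<subseteq> V"
  shows "(\<Sum>x\<in>V. block_avg B v x) = (\<Sum>x\<in>V. v x)"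
  using block_avg_symmetric[OF assms, of v "\<lambda>_. 1"] assms
  by (simp add: block_avg_const finite_subset)

lemma sum_block_avg_swap:
  "(\<Sum>z\<in>V. block_avg B (\<lambda>y. f y z) x) = block_avg B (\<lambda>y. \<Sum>z\<in>V. f y z) x"
  using sum.swap[of f V B]
  by (simp add: block_avg_def sum_divide_distrib[symmetric])

section \<open>The walker in a fixed list of blocks\<close>

text \<open>\<open>path_mass l x z\<close> is the probability that a walker started at \<open>x\<close>, who jumps to a uniform point of
  each block of \<open>l\<close> that contains him, ends at \<open>z\<close>.\<close>

primrec path_mass :: "nat set list \<Rightarrow> nat \<Rightarrow> nat \<Rightarrow> real" where
  "path_mass [] x z = dirac_mass x z"
| "path_mass (B # l) x z = block_avg B (\<lambda>y. path_mass l y z) x"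

text \<open>The part of \<^const>\<open>path_mass\<close> carried by those trajectories for which \<open>w\<close> times the product of
  the sizes of all blocks met reaches the threshold \<open>W\<close>.\<close>

primrec spread_mass :: "real \<Rightarrow> nat set list \<Rightarrow> real \<Rightarrow> nat \<Rightarrow> nat \<Rightarrow> real" where
  "spread_mass W [] w x z = (if W \<le> w then dirac_mass x z else 0)"
| "spread_mass W (B # l) w x z =
    block_avg B (\<lambda>y. spread_mass W l (if x \<in> B then w * real (card B) else w) y z) x"

text \<open>By symmetry the earliest block can be taken off the vector and put on the kernel; this
  is why \<open>path_mass\<close> consumes the earliest block first, as \<open>fold\<close>
  does.\<close>

lemma fold_block_avg_eq_path_mass:
  assumes "finite V" "set l \<subseteq> Pow V" "z \<in> V"
  shows "fold block_avg l v z = (\<Sum>x\<in>V. v x * path_mass l x z)"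
  using assms(2)
proof (induction l arbitrary: v)
  case Nil
  have "(\<Sum>x\<in>V. v x * dirac_mass x z) = (\<Sum>x\<in>V. if x = z then v x else 0)"
    by (intro sum.cong) (auto simp: dirac_mass_def)
  then show ?case using assms by simp
next
  case (Cons B l)
  then show ?case using assms by (simp add: block_avg_symmetric)
qed

lemma fold_block_avg_dirac:
  assumes "finite V" "set l \<subseteq> Pow V" "z \<in> V" "x \<in> V"
  shows "fold block_avg l (dirac_mass x) z = path_mass l x z"
proof -
  have "(\<Sum>y\<in>V. dirac_mass x y * path_mass l y z) = (\<Sum>y\<in>V. if y = x then path_mass l y z else 0)"
    by (intro sum.cong) (auto simp: dirac_mass_def)
  then show ?thesis using assms by (simp add: fold_block_avg_eq_path_mass)
qed

lemma spread_mass_nonneg: "0 \<le> spread_mass W l w x z"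
  by (induction l arbitrary: w x) (auto simp: block_avg_def dirac_mass_def sum_nonneg)

lemma spread_mass_le_path_mass: "spread_mass W l w x z \<le> path_mass l x z"
proof (induction l arbitrary: w x)
  case (Cons B l)
  then show ?case by (auto intro: block_avg_mono)
qed (auto simp: dirac_mass_def)

lemma path_mass_nonneg: "0 \<le> path_mass l x z"
  using spread_mass_nonneg spread_mass_le_path_mass by (rule order_trans)

lemma sum_path_mass:
  assumes "finite V" "set l \<subseteq> Pow V" "x \<in> V"
  shows "(\<Sum>z\<in>V. path_mass l x z) = 1"
  using assms(2,3)
proof (induction l arbitrary: x)
  case Nil
  then show ?case using assms by (simp add: dirac_mass_def)
next
  case (Cons B l)
  have "finite B" using Cons.prems assms(1) by (auto intro: finite_subset)
  have "block_avg B (\<lambda>y. \<Sum>z\<in>V. path_mass l y z) x = block_avg B (\<lambda>y. 1) x"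
    using Cons by (auto simp: block_avg_def subset_iff)
  then show ?case using Cons.prems \<open>finite B\<close> by (simp add: sum_block_avg_swap block_avg_const)
qed

section \<open>Entropy\<close>

text \<open>Minus the Shannon entropy. For a probability vector on \<open>{1..n}\<close>, adding
  \<open>ln n\<close> gives the relative entropy with respect to the uniform law.\<close>

definition entropy_sum :: "nat set \<Rightarrow> (nat \<Rightarrow> real) \<Rightarrow> real" where
  "entropy_sum V v = (\<Sum>x\<in>V. v x * ln (v x))"

text \<open>Let \<open>m\<close> be the mass of \<open>B\<close>. The terms in \<open>B\<close> sum
  to at most \<open>m * ln m\<close> before averaging, since no entry exceeds \<open>m\<close>, and
  to exactly \<open>m * ln (m / card B)\<close> afterwards; the terms outside \<open>B\<close> do
  not change.\<close>

lemma entropy_sum_block_avg: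
  assumes "finite V" "B \<subseteq> V" "B \<noteq> {}" and nonneg: "\<And>x. x \<in> V \<Longrightarrow> 0 \<le> v x"
  shows "entropy_sum V v - (\<Sum>x\<in>B. v x) * ln (card B) \<le> entropy_sum V (block_avg B v)"
proof -
  have finB: "finite B" using assms finite_subset by blast
  have k: "card B > 0" using finB assms by (simp add: card_gt_0_iff)
  define m where "m = (\<Sum>x\<in>B. v x)"
  have m0: "0 \<le> m" unfolding m_def using assms by (auto intro!: sum_nonneg)
  have split: "(\<Sum>x\<in>V. f x) = (\<Sum>x\<in>B. f x) + (\<Sum>x\<in>V - B. f x)" for f :: "nat \<Rightarrow> real"
    using assms by (metis sum.subset_diff add.commute)
  have "(\<Sum>x\<in>B. v x * ln (v x)) \<le> (\<Sum>x\<in>B. v x * ln m)"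
  proof (rule sum_mono)
    fix x assume x: "x \<in> B"
    have "v x \<le> m" unfolding m_def using x finB nonneg assms
      by (intro member_le_sum) auto
    moreover have "0 \<le> v x" using nonneg x assms by blast
    ultimately show "v x * ln (v x) \<le> v x * ln m"
      by (cases "v x = 0") (simp_all add: ln_le_cancel_iff)
  qed
  also have "\<dots> = m * ln m" by (simp add: m_def sum_distrib_right)
  finally have 1: "(\<Sum>x\<in>B. v x * ln (v x)) \<le> m * ln m" .
  have "(\<Sum>x\<in>B. block_avg B v x * ln (block_avg B v x)) = m * ln (m / card B)"
    using k by (simp add: block_avg_def m_def)
  also have "\<dots> = m * ln m - m * ln (card B)"
    using m0 k by (cases "m = 0") (auto simp: ln_div algebra_simps)
  finally have 2: "(\<Sum>x\<in>B. block_avg B v x * ln (block_avg B v x)) = m * ln m - m * ln (card B)" .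
  have 3: "(\<Sum>x\<in>V-B. block_avg B v x * ln (block_avg B v x)) = (\<Sum>x\<in>V-B. v x * ln (v x))"
    by (simp add: block_avg_def)
  show ?thesis unfolding entropy_sum_def
    using split[of "\<lambda>x. v x * ln (v x)"] split[of "\<lambda>x. block_avg B v x * ln (block_avg B v x)"] 1 2 3
    by (simp add: m_def)
qed

text \<open>The relative entropy is bounded site by site by \<open>ln n + 1\<close> times the
  positive part of \<open>v x - 1 / n\<close>, written as half of the absolute value plus the number
  itself.\<close>

lemma entropy_le_tv_norm:
  assumes n: "n \<ge> 1" and nonneg: "\<And>x. x \<in> {1..n} \<Longrightarrow> 0 \<le> v x" and one: "(\<Sum>x\<in>{1..n}. v x) = 1"
  shows "ln n + entropy_sum {1..n} v \<le> tv_norm n (\<lambda>x. v x - 1 / n) * (ln n + 1)"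
proof -
  have N: "real n > 0" using n by simp
  have le1: "v x \<le> 1" if "x \<in> {1..n}" for x
    using member_le_sum[of x "{1..n}" v] that nonneg one by auto
  have pt: "v x * ln n + v x * ln (v x) \<le> (\<bar>v x - 1 / n\<bar> + (v x - 1 / n)) / 2 * (ln n + 1)"
    if x: "x \<in> {1..n}" for x
  proof (cases "v x \<le> 1 / n")
    case True
    have "v x * (ln n + ln (v x)) \<le> 0"
    proof (cases "v x = 0")
      case False
      then have "v x > 0" using nonneg[OF x] by simp
      have "ln n + ln (v x) = ln (n * v x)" using \<open>v x > 0\<close> N by (simp add: ln_mult)
      also have "\<dots> \<le> 0" using True \<open>v x > 0\<close> N by (simp add: field_simps)
      finally show ?thesis using \<open>v x > 0\<close> by (simp add: mult_nonneg_nonpos)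
    qed simp
    then show ?thesis using True by (simp add: algebra_simps)
  next
    case False
    define f where "f = n * v x"
    have f1: "f > 1" using False N by (simp add: f_def field_simps)
    have fn: "f \<le> n" using le1[OF x] N by (simp add: f_def)
    have vf: "v x = f / n" using N by (simp add: f_def)
    \<comment> \<open>Split \<open>f * ln f = ln f + (f - 1) * ln f\<close>; the first term is at
      most \<open>f - 1\<close>, and in the second \<open>ln f\<close> is at most
      \<open>ln n\<close>.\<close>
    have "ln f \<le> f - 1" using ln_le_minus_one[of f] f1 by simp
    moreover have "(f - 1) * ln f \<le> (f - 1) * ln n" using f1 fn by (intro mult_left_mono) auto
    ultimately have "f * ln f \<le> (f - 1) * (ln n + 1)" by (simp add: algebra_simps)
    then have "f * ln f / n \<le> (f - 1) * (ln n + 1) / n" using N by (simp add: divide_right_mono)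
    moreover have "f * ln f / n = v x * ln n + v x * ln (v x)"
      using f1 N by (simp add: vf ln_div field_simps)
    moreover have "(f - 1) * (ln n + 1) / n = (\<bar>v x - 1 / n\<bar> + (v x - 1 / n)) / 2 * (ln n + 1)"
      using False N by (simp add: vf field_simps)
    ultimately show ?thesis by simp
  qed
  \<comment> \<open>The deviations cancel, so their positive parts add up to half the
    \<open>L^1\<close> norm, which is the total variation distance.\<close>
  have z: "(\<Sum>x\<in>{1..n}. v x - 1 / n) = 0" using one N by (simp add: sum_subtractf)
  have "ln n + entropy_sum {1..n} v = (\<Sum>x\<in>{1..n}. v x * ln n + v x * ln (v x))"
    using one by (simp add: entropy_sum_def sum.distrib sum_distrib_right[symmetric])
  also have "\<dots> \<le> (\<Sum>x\<in>{1..n}. (\<bar>v x - 1 / n\<bar> + (v x - 1 / n)) / 2 * (ln n + 1))"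
    by (intro sum_mono pt)
  also have "\<dots> = tv_norm n (\<lambda>x. v x - 1 / n) * (ln n + 1)"
    unfolding tv_norm_def
    by (simp only: sum_distrib_right[symmetric] sum_divide_distrib[symmetric] sum.distrib z) simp
  finally show ?thesis .
qed

section \<open>Moments over i.i.d. blocks\<close>

locale block_law =
  fixes n :: nat and p :: "nat pmf"
  assumes two_le_n: "2 \<le> n" and support: "set_pmf p \<subseteq> {2..n}"
begin

definition V :: "nat set" where "V = {1..n}"

lemma finite_V [simp]: "finite V" and card_V [simp]: "card V = n"
  by (simp_all add: V_def)

definition mean :: "(nat \<Rightarrow> real) \<Rightarrow> real" where
  "mean f = (\<Sum>k\<in>{2..n}. pmf p k * f k)"

lemma expectation_eq_mean: "measure_pmf.expectation p f = mean f"
  unfolding mean_def using support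
  by (subst integral_measure_pmf_real[of "{2..n}"]) (auto simp: mult.commute)

lemma mean_1: "mean (\<lambda>_. 1) = 1"
  using expectation_eq_mean[of "\<lambda>_. 1"] by simp

lemma mean_cmult: "mean (\<lambda>k. c * f k) = c * mean f"
  by (simp add: mean_def sum_distrib_left mult_ac)

lemma mean_divide: "mean (\<lambda>k. f k / c) = mean f / c"
  by (simp add: mean_def sum_divide_distrib)

lemma mean_mono: "(\<And>k. 2 \<le> k \<Longrightarrow> k \<le> n \<Longrightarrow> f k \<le> g k) \<Longrightarrow> mean f \<le> mean g"
  unfolding mean_def by (intro sum_mono mult_left_mono) auto

lemma mean_cong: "(\<And>k. 2 \<le> k \<Longrightarrow> k \<le> n \<Longrightarrow> f k = g k) \<Longrightarrow> mean f = mean g"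
  unfolding mean_def by (intro sum.cong) auto

section \<open>The law of one block and its inclusion probabilities\<close>

definition weight :: "nat set \<Rightarrow> real" where
  "weight B = pmf p (card B) / real (n choose card B)"

lemma weight_nonneg: "0 \<le> weight B"
  by (simp add: weight_def)

lemma weight_nonzeroD:
  assumes "weight B \<noteq> 0" "B \<subseteq> V"
  shows "2 \<le> card B" "card B \<le> n" "finite B" "B \<noteq> {}"
proof -
  have "card B \<in> set_pmf p" using assms by (auto simp: weight_def set_pmf_iff)
  with support show "2 \<le> card B" "card B \<le> n" by auto
  then show "finite B" "B \<noteq> {}" by (auto intro: card_ge_0_finite)
qed

text \<open>Adding \<open>T\<close> is a bijection from the subsets of \<open>V - T\<close> of size
  \<open>k - card T\<close>.\<close>

lemma card_supersets:
  assumes "T \<subseteq> V" "card T \<le> k"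
  shows "card {B \<in> Pow V. card B = k \<and> T \<subseteq> B} = (n - card T) choose (k - card T)"
proof -
  have finT: "finite T" using finite_subset[OF assms(1)] by simp
  have "bij_betw (\<lambda>B. B \<union> T) {S. S \<subseteq> V - T \<and> card S = k - card T} {B \<in> Pow V. card B = k \<and> T \<subseteq> B}"
  proof (rule bij_betw_byWitness[where f' = "\<lambda>B. B - T"])
    show "(\<lambda>B. B \<union> T) ` {S. S \<subseteq> V - T \<and> card S = k - card T} \<subseteq> {B \<in> Pow V. card B = k \<and> T \<subseteq> B}"
    proof (rule image_subsetI)
      fix S assume "S \<in> {S. S \<subseteq> V - T \<and> card S = k - card T}"
      then have S: "S \<subseteq> V - T" "card S = k - card T" by auto
      then have "finite S" by (meson finite_Diff finite_V finite_subset)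
      then have "card (S \<union> T) = card S + card T"
        using finT S by (intro card_Un_disjoint) auto
      then show "S \<union> T \<in> {B \<in> Pow V. card B = k \<and> T \<subseteq> B}" using S assms by auto
    qed
    show "(\<lambda>B. B - T) ` {B \<in> Pow V. card B = k \<and> T \<subseteq> B} \<subseteq> {S. S \<subseteq> V - T \<and> card S = k - card T}"
      using finT by (auto simp: card_Diff_subset)
  qed auto
  from bij_betw_same_card[OF this, symmetric]
  have "card {B \<in> Pow V. card B = k \<and> T \<subseteq> B} = card {S. S \<subseteq> V - T \<and> card S = k - card T}" .
  also have "\<dots> = card (V - T) choose (k - card T)" by (simp add: n_subsets)
  finally show ?thesis using assms finT by (simp add: card_Diff_subset)
qed

text \<open>Group the blocks by size; the quotient of binomials is the probability that a uniform
  block of size \<open>k\<close> contains \<open>T\<close>. As block sizes are at least 2, the bound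
  on \<open>card T\<close> lets \<open>card_supersets\<close> apply to every size.\<close>

lemma sum_weight_supersets:
  assumes "T \<subseteq> V" "card T \<le> 2"
  shows "(\<Sum>B\<in>Pow V. weight B * (if T \<subseteq> B then c (card B) else 0)) =
    mean (\<lambda>k. c k * (real ((n - card T) choose (k - card T)) / real (n choose k)))"
proof -
  let ?g = "\<lambda>B. weight B * (if T \<subseteq> B then c (card B) else 0)"
  have "sum ?g (Pow V) = sum ?g {B \<in> Pow V. card B \<in> {2..n}}"
    using weight_nonzeroD by (intro sum.mono_neutral_right) auto
  also have "\<dots> = (\<Sum>k\<in>{2..n}. sum ?g {B \<in> {B \<in> Pow V. card B \<in> {2..n}}. card B = k})"
    by (intro sum.group[symmetric]) auto
  also have "\<dots> = mean (\<lambda>k. c k * (real ((n - card T) choose (k - card T)) / real (n choose k)))"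
    unfolding mean_def
  proof (intro sum.cong refl)
    fix k assume k: "k \<in> {2..n}"
    have "sum ?g {B \<in> {B \<in> Pow V. card B \<in> {2..n}}. card B = k} =
        sum ?g {B \<in> Pow V. card B = k \<and> T \<subseteq> B}"
      using k by (intro sum.mono_neutral_right) auto
    also have "\<dots> = (\<Sum>B\<in>{B \<in> Pow V. card B = k \<and> T \<subseteq> B}. pmf p k / real (n choose k) * c k)"
      by (intro sum.cong) (auto simp: weight_def)
    also have "\<dots> = pmf p k * (c k * (real ((n - card T) choose (k - card T)) / real (n choose k)))"
      using card_supersets[OF assms(1), of k] k assms by simp
    finally show "sum ?g {B \<in> {B \<in> Pow V. card B \<in> {2..n}}. card B = k} = \<dots>" .
  qed
  finally show ?thesis .
qed

lemma sum_weight: "(\<Sum>B\<in>Pow V. weight B) = 1"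
proof -
  have "(\<Sum>B\<in>Pow V. weight B) = mean (\<lambda>k. real (n choose k) / real (n choose k))"
    using sum_weight_supersets[of "{}" "\<lambda>_. 1"] by simp
  also have "\<dots> = mean (\<lambda>_. 1)" by (intro mean_cong) simp
  finally show ?thesis by (simp add: mean_1)
qed

text \<open>Absorption, \<open>k * (n choose k) = n * ((n - 1) choose (k - 1))\<close>: a block of
  size \<open>k\<close> contains a given site with probability \<open>k / n\<close>, whichever site
  it is.\<close>

lemma sum_weight_mem:
  assumes "y \<in> V"
  shows "(\<Sum>B\<in>Pow V. weight B * (if y \<in> B then c (card B) else 0)) = mean (\<lambda>k. c k * k) / n"
proof -
  have "(\<Sum>B\<in>Pow V. weight B * (if y \<in> B then c (card B) else 0)) =
      mean (\<lambda>k. c k * (real ((n - 1) choose (k - 1)) / real (n choose k)))"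
    using sum_weight_supersets[of "{y}" c] assms by simp
  also have "\<dots> = mean (\<lambda>k. c k * k / n)"
  proof (rule mean_cong)
    fix k assume k: "2 \<le> k" "k \<le> n"
    have "real k * real (n choose k) = real n * real ((n - 1) choose (k - 1))"
      using times_binomial_minus1_eq[of k n] k by (metis of_nat_mult zero_less_numeral less_le_trans)
    moreover have "real (n choose k) > 0" using k by simp
    ultimately have "real ((n - 1) choose (k - 1)) / real (n choose k) = real k / real n"
      using two_le_n by (simp add: field_simps)
    then show "c k * (real ((n - 1) choose (k - 1)) / real (n choose k)) = c k * k / n" by simp
  qed
  finally show ?thesis by (simp add: mean_divide)
qed

text \<open>Absorption applied twice: a block of size \<open>k\<close> contains two given sites with
  probability \<open>k (k - 1) / (n (n - 1))\<close>.\<close>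

lemma sum_weight_mem2:
  assumes "y \<in> V" "y' \<in> V" "y \<noteq> y'"
  shows "(\<Sum>B\<in>Pow V. weight B * (if y \<in> B \<and> y' \<in> B then c (card B) else 0)) =
    mean (\<lambda>k. c k * (k * (real k - 1))) / (n * (real n - 1))"
proof -
  have "(\<Sum>B\<in>Pow V. weight B * (if y \<in> B \<and> y' \<in> B then c (card B) else 0)) =
      mean (\<lambda>k. c k * (real ((n - 2) choose (k - 2)) / real (n choose k)))"
    using sum_weight_supersets[of "{y, y'}" c] assms by (simp add: numeral_2_eq_2)
  also have "\<dots> = mean (\<lambda>k. c k * (k * (real k - 1)) / (n * (real n - 1)))"
  proof (rule mean_cong)
    fix k assume k: "2 \<le> k" "k \<le> n"
    have 1: "real k * real (n choose k) = real n * real ((n - 1) choose (k - 1))"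
      using times_binomial_minus1_eq[of k n] k by (metis of_nat_mult zero_less_numeral less_le_trans)
    have "real (k - 1) * real ((n - 1) choose (k - 1)) = real (n - 1) * real ((n - 1 - 1) choose (k - 1 - 1))"
      using times_binomial_minus1_eq[of "k - 1" "n - 1"] k by (metis of_nat_mult zero_less_diff one_less_numeral_iff less_le_trans semiring_norm(76))
    then have 2: "(real k - 1) * real ((n - 1) choose (k - 1)) = (real n - 1) * real ((n - 2) choose (k - 2))"
      using k by (simp add: of_nat_diff numeral_2_eq_2)
    have pos: "real (n choose k) > 0" "real n > 0" "real n - 1 > 0" using k by auto
    have "real k * (real k - 1) * real (n choose k) = (real k - 1) * (real k * real (n choose k))"
      by simp
    also have "\<dots> = real n * ((real k - 1) * real ((n - 1) choose (k - 1)))"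
      unfolding 1 by simp
    also have "\<dots> = n * (real n - 1) * real ((n - 2) choose (k - 2))" unfolding 2 by simp
    finally have "real ((n - 2) choose (k - 2)) / real (n choose k) = k * (real k - 1) / (n * (real n - 1))"
      using pos by (simp add: field_simps)
    then show "c k * (real ((n - 2) choose (k - 2)) / real (n choose k)) =
        c k * (k * (real k - 1)) / (n * (real n - 1))" by simp
  qed
  finally show ?thesis by (simp add: mean_divide)
qed

section \<open>Expectations over lists of independent blocks\<close>

definition words :: "nat \<Rightarrow> nat set list set" where
  "words s = {l. set l \<subseteq> Pow V \<and> length l = s}"

text \<open>The expectation over \<open>s\<close> independent blocks as a finite sum, so that all
  estimates below avoid measurability and integrability.\<close>

definition list_mean :: "nat \<Rightarrow> (nat set list \<Rightarrow> real) \<Rightarrow> real" where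
  "list_mean s \<Phi> = (\<Sum>l\<in>words s. prod_list (map weight l) * \<Phi> l)"

lemma finite_words: "finite (words s)"
  unfolding words_def by (rule finite_lists_length_eq) simp

lemma list_mean_0: "list_mean 0 \<Phi> = \<Phi> []"
proof -
  have "words 0 = {[]}" by (auto simp: words_def)
  then show ?thesis by (simp add: list_mean_def)
qed

text \<open>Conditioning on the first block; the inductions below all rest on this
  recursion.\<close>

lemma list_mean_Suc: "list_mean (Suc s) \<Phi> = (\<Sum>B\<in>Pow V. weight B * list_mean s (\<lambda>l. \<Phi> (B # l)))"
proof -
  have w: "words (Suc s) = (\<lambda>(B, l). B # l) ` (Pow V \<times> words s)"
  proof (rule set_eqI)
    show "l \<in> words (Suc s) \<longleftrightarrow> l \<in> (\<lambda>(B, l). B # l) ` (Pow V \<times> words s)" for l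
      by (cases l) (simp_all add: words_def image_iff)
  qed
  have inj: "inj_on (\<lambda>(B, l). B # l) (Pow V \<times> words s)" by (auto simp: inj_on_def)
  have "list_mean (Suc s) \<Phi> = (\<Sum>(B, l)\<in>Pow V \<times> words s. weight B * prod_list (map weight l) * \<Phi> (B # l))"
    unfolding list_mean_def w sum.reindex[OF inj] by (intro sum.cong) auto
  also have "\<dots> = (\<Sum>B\<in>Pow V. \<Sum>l\<in>words s. weight B * prod_list (map weight l) * \<Phi> (B # l))"
    by (simp add: sum.cartesian_product finite_words)
  finally show ?thesis by (simp add: list_mean_def sum_distrib_left mult.assoc)
qed

lemma list_mean_add: "list_mean s (\<lambda>l. f l + g l) = list_mean s f + list_mean s g"
  by (simp add: list_mean_def sum.distrib algebra_simps)

lemma list_mean_diff: "list_mean s (\<lambda>l. f l - g l) = list_mean s f - list_mean s g"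
  by (simp add: list_mean_def sum_subtractf algebra_simps)

lemma list_mean_cmult: "list_mean s (\<lambda>l. c * f l) = c * list_mean s f"
  by (simp add: list_mean_def sum_distrib_left mult_ac)

lemma list_mean_divide: "list_mean s (\<lambda>l. f l / c) = list_mean s f / c"
  by (simp add: list_mean_def sum_divide_distrib)

lemma list_mean_sum: "list_mean s (\<lambda>l. \<Sum>i\<in>I. f i l) = (\<Sum>i\<in>I. list_mean s (f i))"
  unfolding list_mean_def sum_distrib_left by (rule sum.swap)

lemma list_mean_mono:
  assumes "\<And>l. set l \<subseteq> Pow V \<Longrightarrow> f l \<le> g l"
  shows "list_mean s f \<le> list_mean s g"
  unfolding list_mean_def using assms
  by (intro sum_mono mult_left_mono prod_list_nonneg) (auto simp: words_def weight_nonneg)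

lemma list_mean_const: "list_mean s (\<lambda>_. c) = c"
proof (induction s)
  case (Suc s)
  then show ?case by (simp add: list_mean_Suc sum_distrib_right[symmetric] sum_weight)
qed (simp add: list_mean_0)

text \<open>Sets whose size is outside the support of \<open>p\<close> have weight zero, so only
  blocks of admissible size need to be compared.\<close>

lemma sum_weight_mono:
  assumes "\<And>B. B \<subseteq> V \<Longrightarrow> 2 \<le> card B \<Longrightarrow> card B \<le> n \<Longrightarrow> finite B \<Longrightarrow> B \<noteq> {} \<Longrightarrow> f B \<le> g B"
  shows "(\<Sum>B\<in>Pow V. weight B * f B) \<le> (\<Sum>B\<in>Pow V. weight B * g B)"
proof (rule sum_mono)
  fix B assume "B \<in> Pow V"
  then show "weight B * f B \<le> weight B * g B"
    using assms[of B] weight_nonzeroD[of B] weight_nonneg[of B]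
    by (cases "weight B = 0") (auto intro!: mult_left_mono)
qed

lemma sum_weight_cong:
  assumes "\<And>B. B \<subseteq> V \<Longrightarrow> 2 \<le> card B \<Longrightarrow> card B \<le> n \<Longrightarrow> finite B \<Longrightarrow> B \<noteq> {} \<Longrightarrow> f B = g B"
  shows "(\<Sum>B\<in>Pow V. weight B * f B) = (\<Sum>B\<in>Pow V. weight B * g B)"
  using sum_weight_mono[of f g] sum_weight_mono[of g f] assms by (simp add: order_antisym)

lemma list_mean_block_avg:
  "list_mean s (\<lambda>l. block_avg B (f l) y) = block_avg B (\<lambda>u. list_mean s (\<lambda>l. f l u)) y"
  by (simp add: block_avg_def list_mean_divide list_mean_sum)

text \<open>First-step analysis for two walkers: after the common block \<open>B\<close> they stand
  at \<open>u\<close> and \<open>u'\<close>, and the remaining blocks act from there.\<close>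

lemma list_mean_block_avg_product:
  "list_mean s (\<lambda>l. \<Sum>z\<in>V. block_avg B (\<lambda>u. f l u z) y * block_avg B (\<lambda>u. f l u z) y') =
    block_avg B (\<lambda>u. block_avg B (\<lambda>u'. list_mean s (\<lambda>l. \<Sum>z\<in>V. f l u z * f l u' z)) y') y"
  by (simp add: block_avg_mult sum_block_avg_swap list_mean_block_avg)

section \<open>Expected loss of entropy\<close>

definition mean_entropy_loss :: real where
  "mean_entropy_loss = mean (\<lambda>k. k * ln k) / n"

lemma list_mean_entropy_sum_ge:
  assumes "\<And>x. x \<in> V \<Longrightarrow> 0 \<le> v x" "(\<Sum>x\<in>V. v x) = 1"
  shows "entropy_sum V v - s * mean_entropy_loss \<le> list_mean s (\<lambda>l. entropy_sum V (fold block_avg l v))"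
  using assms
proof (induction s arbitrary: v)
  case 0
  then show ?case by (simp add: list_mean_0)
next
  case (Suc s)
  \<comment> \<open>Every site has the same chance of lying in a block of given size, so the
    expected loss is the same for every \<open>v\<close> of total mass 1. Hence the induction can go
    on from the random vector \<open>block_avg B v\<close>.\<close>
  have loss: "(\<Sum>B\<in>Pow V. weight B * ((\<Sum>x\<in>B. v x) * ln (card B))) = mean_entropy_loss"
  proof -
    have "(\<Sum>B\<in>Pow V. weight B * ((\<Sum>x\<in>B. v x) * ln (card B))) =
        (\<Sum>B\<in>Pow V. \<Sum>x\<in>V. v x * (weight B * (if x \<in> B then ln (card B) else 0)))"
    proof (intro sum.cong refl)
      fix B assume "B \<in> Pow V"
      then have "(\<Sum>x\<in>B. v x) = (\<Sum>x\<in>V. if x \<in> B then v x else 0)"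
        by (simp add: sum.If_cases Int_absorb1)
      then show "weight B * ((\<Sum>x\<in>B. v x) * ln (card B)) =
          (\<Sum>x\<in>V. v x * (weight B * (if x \<in> B then ln (card B) else 0)))"
        by (auto simp: sum_distrib_left sum_distrib_right intro!: sum.cong)
    qed
    also have "\<dots> = (\<Sum>x\<in>V. v x * (\<Sum>B\<in>Pow V. weight B * (if x \<in> B then ln (card B) else 0)))"
      unfolding sum_distrib_left by (rule sum.swap)
    also have "\<dots> = (\<Sum>x\<in>V. v x * mean_entropy_loss)"
    proof (intro sum.cong refl)
      fix x assume "x \<in> V"
      then show "v x * (\<Sum>B\<in>Pow V. weight B * (if x \<in> B then ln (card B) else 0)) = v x * mean_entropy_loss"
        using sum_weight_mem[of x "\<lambda>k. ln k"] by (simp add: mean_entropy_loss_def mult.commute)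
    qed
    finally show ?thesis using Suc.prems by (simp add: sum_distrib_right[symmetric])
  qed
  have "entropy_sum V v - Suc s * mean_entropy_loss =
      (\<Sum>B\<in>Pow V. weight B * (entropy_sum V v - (\<Sum>x\<in>B. v x) * ln (card B) - s * mean_entropy_loss))"
  proof -
    have "(\<Sum>B\<in>Pow V. weight B * (entropy_sum V v - (\<Sum>x\<in>B. v x) * ln (card B) - s * mean_entropy_loss)) =
        (\<Sum>B\<in>Pow V. weight B * (entropy_sum V v - s * mean_entropy_loss) - weight B * ((\<Sum>x\<in>B. v x) * ln (card B)))"
      by (intro sum.cong refl) (simp add: algebra_simps)
    also have "\<dots> = entropy_sum V v - s * mean_entropy_loss - mean_entropy_loss"
      unfolding sum_subtractf loss by (simp only: sum_distrib_right[symmetric] sum_weight mult_1)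
    finally show ?thesis by (simp add: algebra_simps)
  qed
  also have "\<dots> \<le> (\<Sum>B\<in>Pow V. weight B * list_mean s (\<lambda>l. entropy_sum V (fold block_avg (B # l) v)))"
  proof (rule sum_weight_mono)
    fix B assume B: "B \<subseteq> V" "B \<noteq> {}" "finite B"
    have "0 \<le> block_avg B v x" if "x \<in> V" for x
      using that Suc.prems B by (auto simp: block_avg_def intro!: sum_nonneg divide_nonneg_nonneg)
    moreover have "(\<Sum>x\<in>V. block_avg B v x) = 1" using Suc.prems B by (simp add: sum_block_avg)
    ultimately have "entropy_sum V (block_avg B v) - s * mean_entropy_loss
        \<le> list_mean s (\<lambda>l. entropy_sum V (fold block_avg l (block_avg B v)))"
      by (rule Suc.IH)
    moreover have "entropy_sum V v - (\<Sum>x\<in>B. v x) * ln (card B) \<le> entropy_sum V (block_avg B v)"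
      using B Suc.prems by (intro entropy_sum_block_avg) auto
    ultimately show "entropy_sum V v - (\<Sum>x\<in>B. v x) * ln (card B) - s * mean_entropy_loss
        \<le> list_mean s (\<lambda>l. entropy_sum V (fold block_avg (B # l) v))" by simp
  qed
  finally show ?case by (simp add: list_mean_Suc)
qed

section \<open>Two walkers using the same blocks\<close>

definition gap :: real where
  "gap = mean (\<lambda>k. real k - 1) / (real n - 1)"

lemma gap_bounds: "0 \<le> gap" "gap \<le> 1"
proof -
  have "mean (\<lambda>k. real k - 1) \<le> mean (\<lambda>k. (real n - 1) * 1)" by (intro mean_mono) auto
  then have "mean (\<lambda>k. real k - 1) \<le> real n - 1" unfolding mean_cmult mean_1 by simp
  then show "gap \<le> 1" using two_le_n by (simp add: gap_def)
  have "mean (\<lambda>k. 0 * 1) \<le> mean (\<lambda>k. real k - 1)" by (intro mean_mono) auto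
  then have "0 \<le> mean (\<lambda>k. real k - 1)" unfolding mean_cmult by simp
  then show "0 \<le> gap" using two_le_n by (simp add: gap_def)
qed

text \<open>This is the probability that the two walkers end at the same site. The number
  \<open>1 - gap\<close> is the eigenvalue on mean-zero vectors of the block average operator
  averaged over the block, and its powers govern the decay of the diagonal term.\<close>

lemma list_mean_path_mass_product:
  assumes "y \<in> V" "y' \<in> V"
  shows "list_mean s (\<lambda>l. \<Sum>z\<in>V. path_mass l y z * path_mass l y' z) =
    (1 - (1 - gap) ^ s) / n + (if y = y' then (1 - gap) ^ s else 0)"
  using assms
proof (induction s arbitrary: y y')
  case 0
  have "(\<Sum>z\<in>V. dirac_mass y z * dirac_mass y' z) = (\<Sum>z\<in>V. if z = y then dirac_mass y' y else 0)"
    by (intro sum.cong) (auto simp: dirac_mass_def)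
  then show ?case using 0 by (simp add: list_mean_0) (simp add: dirac_mass_def)
next
  case (Suc s)
  define r where "r = (1 - gap) ^ s"
  define a where "a = mean (\<lambda>k. real k - 1)"
  define J where "J B = (if y \<in> B \<and> y' \<in> B then 1 / real (card B) else if y = y' then 1 else 0)" for B
  have N: "real n \<ge> 2" using two_le_n by simp
  have ga: "gap = a / (real n - 1)" by (simp add: gap_def a_def)
  have "list_mean (Suc s) (\<lambda>l. \<Sum>z\<in>V. path_mass l y z * path_mass l y' z) =
      (\<Sum>B\<in>Pow V. weight B * ((1 - r) / n + r * J B))"
    unfolding list_mean_Suc
  proof (rule sum_weight_cong)
    fix B assume B: "B \<subseteq> V" "finite B" "B \<noteq> {}"
    have "list_mean s (\<lambda>l. \<Sum>z\<in>V. path_mass (B # l) y z * path_mass (B # l) y' z) =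
        block_avg B (\<lambda>u. block_avg B (\<lambda>u'. (1 - r) / n + (if u = u' then r else 0)) y') y"
      unfolding path_mass.simps list_mean_block_avg_product r_def
      using Suc.prems B by (intro block_avg_cong Suc.IH) auto
    also have "\<dots> = (1 - r) / n + r * J B"
      using B by (simp add: block_avg_block_avg_diagonal J_def)
    finally show "list_mean s (\<lambda>l. \<Sum>z\<in>V. path_mass (B # l) y z * path_mass (B # l) y' z) = (1 - r) / n + r * J B" .
  qed
  also have "\<dots> = (1 - r) / n + r * (\<Sum>B\<in>Pow V. weight B * J B)"
  proof -
    have "(\<Sum>B\<in>Pow V. weight B * ((1 - r) / n + r * J B)) =
        (\<Sum>B\<in>Pow V. weight B) * ((1 - r) / n) + r * (\<Sum>B\<in>Pow V. weight B * J B)"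
      by (simp only: sum_distrib_left sum_distrib_right distrib_left sum.distrib mult.left_commute)
    then show ?thesis by (simp add: sum_weight)
  qed
  \<comment> \<open>\<open>J B\<close> is the probability that the walkers are together after the
    block \<open>B\<close>. The same \<open>a\<close> appears in both cases, because
    \<open>k (1 - 1 / k)\<close> and \<open>k (k - 1) / k\<close> both equal
    \<open>k - 1\<close>.\<close>
  also have "(\<Sum>B\<in>Pow V. weight B * J B) = (if y = y' then 1 - a / n else a / (n * (real n - 1)))"
  proof (cases "y = y'")
    case True
    have "(\<Sum>B\<in>Pow V. weight B * J B) =
        (\<Sum>B\<in>Pow V. weight B - weight B * (if y \<in> B then 1 - 1 / real (card B) else 0))"
      using True by (intro sum.cong) (auto simp: J_def algebra_simps)
    also have "\<dots> = 1 - mean (\<lambda>k. (1 - 1 / real k) * k) / n"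
      using sum_weight_mem[OF Suc.prems(1), of "\<lambda>k. 1 - 1 / real k"] by (simp add: sum_subtractf sum_weight)
    also have "mean (\<lambda>k. (1 - 1 / real k) * k) = a"
      unfolding a_def by (intro mean_cong) (simp add: field_simps)
    finally show ?thesis using True by simp
  next
    case False
    have "(\<Sum>B\<in>Pow V. weight B * J B) =
        (\<Sum>B\<in>Pow V. weight B * (if y \<in> B \<and> y' \<in> B then 1 / real (card B) else 0))"
      using False by (intro sum.cong) (auto simp: J_def)
    also have "\<dots> = mean (\<lambda>k. 1 / real k * (k * (real k - 1))) / (n * (real n - 1))"
      using sum_weight_mem2[OF Suc.prems False, of "\<lambda>k. 1 / real k"] by simp
    also have "mean (\<lambda>k. 1 / real k * (k * (real k - 1))) = a"
      unfolding a_def by (intro mean_cong) simp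
    finally show ?thesis using False by simp
  qed
  \<comment> \<open>The mean of \<open>J\<close> is \<open>gap / n\<close>, plus
    \<open>1 - gap\<close> on the diagonal, so the form "constant plus multiple of the diagonal" is
    reproduced.\<close>
  also have "(1 - r) / n + r * (if y = y' then 1 - a / n else a / (n * (real n - 1))) =
      (1 - (1 - gap) * r) / n + (if y = y' then (1 - gap) * r else 0)"
  proof (cases "y = y'")
    case True
    have "a = gap * (real n - 1)" using N by (simp add: ga)
    then have diag: "1 - a / n = 1 - gap + gap / n" using N by (simp add: field_simps)
    show ?thesis unfolding if_P[OF True] diag using N by (simp add: field_simps)
  next
    case False
    have "a / (n * (real n - 1)) = gap / n" by (simp add: ga)
    then show ?thesis using False by (simp add: algebra_simps diff_divide_distrib add_divide_distrib)
  qed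
  finally show ?case by (simp add: r_def)
qed

lemma list_mean_path_mass_product_le:
  assumes "y \<in> V" "y' \<in> V" "y \<noteq> y'"
  shows "list_mean s (\<lambda>l. \<Sum>z\<in>V. path_mass l y z * path_mass l y' z) \<le> 1 / n"
  using assms gap_bounds by (simp add: list_mean_path_mass_product divide_right_mono)

section \<open>Second moment and missing mass of the spread trajectories\<close>

text \<open>Induction on the first block: two walkers at the same point of a block of size \<open>k\<close> stay together
  with probability \<open>1 / k\<close>, while \<open>w\<close> is multiplied by \<open>k\<close>, so the term \<open>w / W\<close> is preserved.\<close>

lemma list_mean_spread_mass_square_le:
  assumes "x \<in> V" "0 \<le> w" "0 < W"
  shows "list_mean s (\<lambda>l. \<Sum>z\<in>V. spread_mass W l w x z * spread_mass W l w x z) \<le> 1 / n + w / W"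
  using assms(1,2)
proof (induction s arbitrary: x w)
  case 0
  have "(\<Sum>z\<in>V. spread_mass W [] w x z * spread_mass W [] w x z) = (\<Sum>z\<in>V. if z = x then (if W \<le> w then 1 else 0) else 0)"
    by (intro sum.cong) (auto simp: dirac_mass_def)
  \<comment> \<open>The indicator of \<open>W \<le> w\<close> is at most
    \<open>w / W\<close>.\<close>
  also have "\<dots> \<le> w / W" using 0 assms by simp
  finally show ?case by (simp add: list_mean_0 add_increasing)
next
  case (Suc s)
  have "list_mean (Suc s) (\<lambda>l. \<Sum>z\<in>V. spread_mass W l w x z * spread_mass W l w x z)
      \<le> (\<Sum>B\<in>Pow V. weight B * (1 / n + w / W))"
    unfolding list_mean_Suc
  proof (rule sum_weight_mono)
    fix B assume B: "B \<subseteq> V" "finite B" "B \<noteq> {}"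
    define w' where "w' = (if x \<in> B then w * real (card B) else w)"
    have w': "0 \<le> w'" using Suc.prems by (simp add: w'_def)
    \<comment> \<open>Walkers still together fall under the induction hypothesis with the updated
      weight \<open>w'\<close>. For separated walkers the threshold is dropped and their meeting
      probability is at most \<open>1 / n\<close>.\<close>
    have pair: "list_mean s (\<lambda>l. \<Sum>z\<in>V. spread_mass W l w' u z * spread_mass W l w' u' z)
        \<le> 1 / n + (if u = u' then w' / W else 0)" if u: "u \<in> V" "u' \<in> V" for u u'
    proof (cases "u = u'")
      case True
      then show ?thesis using Suc.IH[OF u(1) w'] by simp
    next
      case False
      have "list_mean s (\<lambda>l. \<Sum>z\<in>V. spread_mass W l w' u z * spread_mass W l w' u' z)
          \<le> list_mean s (\<lambda>l. \<Sum>z\<in>V. path_mass l u z * path_mass l u' z)"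
        by (intro list_mean_mono sum_mono mult_mono spread_mass_le_path_mass spread_mass_nonneg path_mass_nonneg)
      then show ?thesis using list_mean_path_mass_product_le[OF u False, of s] False by simp
    qed
    have "list_mean s (\<lambda>l. \<Sum>z\<in>V. spread_mass W (B # l) w x z * spread_mass W (B # l) w x z) =
        block_avg B (\<lambda>u. block_avg B (\<lambda>u'. list_mean s (\<lambda>l. \<Sum>z\<in>V. spread_mass W l w' u z * spread_mass W l w' u' z)) x) x"
      unfolding spread_mass.simps w'_def[symmetric] list_mean_block_avg_product ..
    also have "\<dots> \<le> block_avg B (\<lambda>u. block_avg B (\<lambda>u'. 1 / n + (if u = u' then w' / W else 0)) x) x"
      using B Suc.prems by (intro block_avg_mono pair) auto
    also have "\<dots> = 1 / n + w' / W * (if x \<in> B then 1 / card B else 1)"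
      using B by (simp add: block_avg_block_avg_diagonal)
    also have "\<dots> = 1 / n + w / W" using B by (auto simp: w'_def card_gt_0_iff)
    finally show "list_mean s (\<lambda>l. \<Sum>z\<in>V. spread_mass W (B # l) w x z * spread_mass W (B # l) w x z)
        \<le> 1 / n + w / W" .
  qed
  then show ?case by (simp add: sum_weight flip: sum_distrib_right)
qed

text \<open>Exponential Markov bound: if \<open>w\<close> times the product of the sizes met is
  below \<open>W\<close>, then \<open>W / w\<close> over that product, raised to the power \<theta>,
  is at least 1. Each step contributes a mean factor independent of the walker's position, as every
  site is hit with the same probability.\<close>

lemma list_mean_unspread_mass_le:
  assumes "x \<in> V" "0 < w" "0 < W" "0 \<le> \<theta>"
  shows "list_mean s (\<lambda>l. 1 - (\<Sum>z\<in>V. spread_mass W l w x z))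
    \<le> (W / w) powr \<theta> * (1 - mean (\<lambda>k. (1 - k powr - \<theta>) * k) / n) ^ s"
  using assms(1,2)
proof (induction s arbitrary: x w)
  case 0
  have "(\<Sum>z\<in>V. spread_mass W [] w x z) = (\<Sum>z\<in>V. if z = x then (if W \<le> w then 1 else 0) else 0)"
    by (intro sum.cong) (auto simp: dirac_mass_def)
  then have "1 - (\<Sum>z\<in>V. spread_mass W [] w x z) = (if W \<le> w then 0 else 1)" using 0 by simp
  also have "\<dots> \<le> (W / w) powr \<theta>" using 0 assms by (simp add: ge_one_powr_ge_zero)
  finally show ?case by (simp add: list_mean_0)
next
  case (Suc s)
  define q where "q = mean (\<lambda>k. (1 - k powr - \<theta>) * k) / n"
  define c where "c = (W / w) powr \<theta> * (1 - q) ^ s"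
  have "list_mean (Suc s) (\<lambda>l. 1 - (\<Sum>z\<in>V. spread_mass W l w x z))
      \<le> (\<Sum>B\<in>Pow V. weight B * (c * (1 - (if x \<in> B then 1 - card B powr - \<theta> else 0))))"
    unfolding list_mean_Suc
  proof (rule sum_weight_mono)
    fix B assume B: "B \<subseteq> V" "finite B" "B \<noteq> {}"
    then have k: "card B > 0" by (simp add: card_gt_0_iff)
    define w' where "w' = (if x \<in> B then w * real (card B) else w)"
    have w': "0 < w'" using Suc.prems k by (simp add: w'_def)
    have "1 - (\<Sum>z\<in>V. spread_mass W (B # l) w x z) =
        block_avg B (\<lambda>y. 1 - (\<Sum>z\<in>V. spread_mass W l w' y z)) x" for l
      using B by (simp add: w'_def[symmetric] sum_block_avg_swap block_avg_diff block_avg_const)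
    then have "list_mean s (\<lambda>l. 1 - (\<Sum>z\<in>V. spread_mass W (B # l) w x z)) =
        block_avg B (\<lambda>y. list_mean s (\<lambda>l. 1 - (\<Sum>z\<in>V. spread_mass W l w' y z))) x"
      by (simp add: list_mean_block_avg)
    also have "\<dots> \<le> block_avg B (\<lambda>y. (W / w') powr \<theta> * (1 - q) ^ s) x"
      using Suc.IH[OF _ w'] B Suc.prems unfolding q_def by (intro block_avg_mono) auto
    also have "\<dots> = (W / w') powr \<theta> * (1 - q) ^ s" using B by (simp add: block_avg_const)
    also have "\<dots> = c * (1 - (if x \<in> B then 1 - card B powr - \<theta> else 0))"
      using k Suc.prems assms by (simp add: w'_def c_def powr_divide powr_mult powr_minus field_simps)
    finally show "list_mean s (\<lambda>l. 1 - (\<Sum>z\<in>V. spread_mass W (B # l) w x z))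
        \<le> c * (1 - (if x \<in> B then 1 - card B powr - \<theta> else 0))" .
  qed
  also have "\<dots> = c * (\<Sum>B\<in>Pow V. weight B - weight B * (if x \<in> B then 1 - card B powr - \<theta> else 0))"
    by (simp add: sum_distrib_left algebra_simps)
  also have "\<dots> = c * (1 - q)"
    using sum_weight_mem[OF Suc.prems(1), of "\<lambda>k. 1 - k powr - \<theta>"]
    by (simp add: sum_subtractf sum_weight q_def)
  finally show ?case by (simp add: c_def q_def mult_ac)
qed

section \<open>From the moments to bounds on the total variation distance\<close>

lemma tv_norm_path_mass_le:
  fixes W w e :: real
  assumes l: "set l \<subseteq> Pow V" and x: "x \<in> V" and e: "0 < e"
  defines "m \<equiv> \<Sum>z\<in>V. spread_mass W l w x z"
  shows "tv_norm n (\<lambda>z. path_mass l x z - 1 / n)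
    \<le> e / 4 + (n * (\<Sum>z\<in>V. spread_mass W l w x z * spread_mass W l w x z) - 1) / (4 * e)
      + (1 / (2 * e) + 1) * (1 - m)"
proof -
  let ?G = "spread_mass W l w x" and ?H = "path_mass l x"
  have N: "real n > 0" using two_le_n by simp
  have sumH: "(\<Sum>z\<in>V. ?H z) = 1" using l x by (simp add: sum_path_mass)
  have "m \<le> (\<Sum>z\<in>V. ?H z)" unfolding m_def by (intro sum_mono spread_mass_le_path_mass)
  then have m1: "m \<le> 1" using sumH by simp
  \<comment> \<open>Expanding a square replaces Cauchy-Schwarz: the bound is linear in the second
    moment, so it can be averaged over the blocks.\<close>
  have amgm: "\<bar>a\<bar> \<le> e / (2 * n) + n * a\<^sup>2 / (2 * e)" for a :: real
  proof -
    have "0 \<le> (e - n * \<bar>a\<bar>)\<^sup>2" by simp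
    then have "2 * e * n * \<bar>a\<bar> \<le> e\<^sup>2 + (n * a)\<^sup>2" by (simp add: power2_diff power_mult_distrib mult_ac)
    then show ?thesis using N e by (simp add: field_simps power2_eq_square)
  qed
  have "(\<Sum>z\<in>V. \<bar>?H z - 1 / n\<bar>)
      \<le> (\<Sum>z\<in>V. e / (2 * n) + n / (2 * e) * (?G z - m / n)\<^sup>2 + (?H z - ?G z) + (1 - m) / n)"
  proof (rule sum_mono)
    fix z
    \<comment> \<open>Compare the spread part with the uniform vector of the same mass
      \<open>m\<close>; the two remaining terms each sum to the missing mass
      \<open>1 - m\<close>.\<close>
    have "?H z - 1 / n = (?G z - m / n) + (?H z - ?G z) - (1 - m) / n"
      by (simp add: diff_divide_distrib)
    moreover have "0 \<le> ?H z - ?G z" using spread_mass_le_path_mass by simp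
    moreover have "0 \<le> (1 - m) / n" using m1 by simp
    ultimately have "\<bar>?H z - 1 / n\<bar> \<le> \<bar>?G z - m / n\<bar> + (?H z - ?G z) + (1 - m) / n" by linarith
    with amgm[of "?G z - m / n"]
    show "\<bar>?H z - 1 / n\<bar> \<le> e / (2 * n) + n / (2 * e) * (?G z - m / n)\<^sup>2 + (?H z - ?G z) + (1 - m) / n"
      by simp
  qed
  also have "\<dots> = e / 2 + n / (2 * e) * (\<Sum>z\<in>V. (?G z - m / n)\<^sup>2) + 2 * (1 - m)"
    using N by (simp add: sum.distrib sum_subtractf sumH m_def[symmetric] sum_distrib_left[symmetric]
        sum_divide_distrib[symmetric])
  also have "(\<Sum>z\<in>V. (?G z - m / n)\<^sup>2) = (\<Sum>z\<in>V. ?G z * ?G z) - m\<^sup>2 / n"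
  proof -
    have "(\<Sum>z\<in>V. (?G z - m / n)\<^sup>2) = (\<Sum>z\<in>V. ?G z * ?G z - 2 * m / n * ?G z + (m / n)\<^sup>2)"
      by (intro sum.cong refl) (simp add: power2_eq_square algebra_simps)
    also have "\<dots> = (\<Sum>z\<in>V. ?G z * ?G z) - 2 * m / n * m + n * (m / n)\<^sup>2"
      by (simp only: sum.distrib sum_subtractf sum_distrib_left[symmetric] m_def[symmetric]) simp
    also have "\<dots> = (\<Sum>z\<in>V. ?G z * ?G z) - m\<^sup>2 / n" using N by (simp add: power2_eq_square field_simps)
    finally show ?thesis .
  qed
  also have "n / (2 * e) * ((\<Sum>z\<in>V. ?G z * ?G z) - m\<^sup>2 / n) = (n * (\<Sum>z\<in>V. ?G z * ?G z) - m\<^sup>2) / (2 * e)"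
    using N e by (simp add: field_simps)
  also have "\<dots> \<le> (n * (\<Sum>z\<in>V. ?G z * ?G z) - (1 - 2 * (1 - m))) / (2 * e)"
  \<comment> \<open>Replacing \<open>m\<^sup>2\<close> by its tangent at 1 makes the bound linear in
    \<open>m\<close> as well.\<close>
  proof -
    have "0 \<le> (m - 1)\<^sup>2" by simp
    then have "1 - 2 * (1 - m) \<le> m\<^sup>2" by (simp add: power2_diff)
    then show ?thesis using e by (intro divide_right_mono) auto
  qed
  finally have "tv_norm n (\<lambda>z. ?H z - 1 / n)
      \<le> 1 / 2 * (e / 2 + (n * (\<Sum>z\<in>V. ?G z * ?G z) - (1 - 2 * (1 - m))) / (2 * e) + 2 * (1 - m))"
    unfolding tv_norm_def V_def[symmetric] by simp
  also have "\<dots> = e / 4 + (n * (\<Sum>z\<in>V. ?G z * ?G z) - 1) / (4 * e) + (1 / (2 * e) + 1) * (1 - m)"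
    using e by (simp add: field_simps)
  finally show ?thesis .
qed

lemma list_mean_tv_norm_le:
  fixes e :: real
  assumes x: "x \<in> V" and e: "0 < e"
  shows "list_mean s (\<lambda>l. tv_norm n (\<lambda>z. path_mass l x z - 1 / n))
    \<le> e / 4 + 1 / (4 * e * n) + (1 / (2 * e) + 1) * (exp 2 * exp (- (s / (2 * t_ent n p))))"
proof -
  \<comment> \<open>With \<open>W = n^2\<close> the diagonal contributes only
    \<open>n / W = 1 / n\<close> to the normalised second moment. With \<theta>
    \<open>= 1 / ln n\<close> the factor \<open>W powr \<theta>\<close> is the constant
    \<open>exp 2\<close>, while \<open>k powr - \<theta>\<close> is \<open>exp (- u)\<close> with
    \<open>u = ln k / ln n\<close> in \<open>[0, 1]\<close>.\<close>
  define W where "W = (real n)\<^sup>2"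
  define \<theta> where "\<theta> = 1 / ln (real n)"
  define q where "q = mean (\<lambda>k. (1 - k powr - \<theta>) * k) / n"
  let ?S = "\<lambda>l. \<Sum>z\<in>V. spread_mass W l 1 x z * spread_mass W l 1 x z"
  let ?m = "\<lambda>l. \<Sum>z\<in>V. spread_mass W l 1 x z"
  have N: "real n \<ge> 2" and L: "ln (real n) > 0" using two_le_n by auto
  have W: "W > 0" using N by (simp add: W_def)
  have W\<theta>: "W powr \<theta> = exp 2" using N L by (simp add: W_def \<theta>_def powr_def ln_realpow)
  have "mean (\<lambda>k. 1 / (2 * ln n) * (k * ln k)) \<le> mean (\<lambda>k. (1 - k powr - \<theta>) * k)"
  proof (rule mean_mono)
    fix k assume k: "2 \<le> k" "k \<le> n"
    define u where "u = ln k / ln n"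
    have u: "0 \<le> u" "u \<le> 1" using k L by (auto simp: u_def)
    \<comment> \<open>On \<open>[0, 1]\<close> this gives \<open>u / 2 \<le> 1 - exp (- u)\<close>;
      averaged against \<open>k\<close>, it turns \<open>q\<close> into a multiple of
      \<open>1 / t_ent\<close>.\<close>
    have "1 + u \<le> exp u" by (rule exp_ge_add_one_self)
    then have "exp (- u) \<le> 1 / (1 + u)" using u by (simp add: exp_minus divide_simps)
    also have "\<dots> \<le> 1 - u / 2" using u by (simp add: field_simps mult_left_le)
    finally have "u / 2 \<le> 1 - k powr - \<theta>" using k by (simp add: powr_def \<theta>_def u_def)
    then have "u / 2 * k \<le> (1 - k powr - \<theta>) * k" by (intro mult_right_mono) auto
    then show "1 / (2 * ln n) * (k * ln k) \<le> (1 - k powr - \<theta>) * k" by (simp add: u_def mult_ac)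
  qed
  then have "mean (\<lambda>k. k * ln k) / (2 * ln n) \<le> mean (\<lambda>k. (1 - k powr - \<theta>) * k)"
    by (simp add: mean_divide)
  then have "mean (\<lambda>k. k * ln k) / (2 * ln n) / n \<le> q" unfolding q_def by (intro divide_right_mono) auto
  then have q: "1 / (2 * t_ent n p) \<le> q"
    by (simp add: t_ent_def expectation_eq_mean mult_ac)
  \<comment> \<open>This gives \<open>q \<le> 1\<close>, so that \<open>1 - q\<close> is nonnegative
    and its power can be compared with that of \<open>exp (- q)\<close>.\<close>
  have "mean (\<lambda>k. (1 - k powr - \<theta>) * k) \<le> mean (\<lambda>k. real n * 1)"
  proof (rule mean_mono)
    fix k :: nat assume k: "2 \<le> k" "k \<le> n"
    have "(1 - k powr - \<theta>) * k \<le> 1 * real k" by (intro mult_right_mono) auto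
    also have "\<dots> \<le> real n * 1" using k by simp
    finally show "(1 - k powr - \<theta>) * k \<le> real n * 1" .
  qed
  then have "q \<le> 1" unfolding mean_cmult mean_1 q_def using N by simp
  then have "(1 - q) ^ s \<le> exp (- q) ^ s"
    using exp_ge_add_one_self[of "- q"] by (intro power_mono) auto
  also have "\<dots> = exp (- (s * q))" by (simp add: exp_of_nat_mult[symmetric])
  also have "\<dots> \<le> exp (- (s / (2 * t_ent n p)))"
    using mult_left_mono[OF q, of "real s"] by simp
  finally have "exp 2 * (1 - q) ^ s \<le> exp 2 * exp (- (s / (2 * t_ent n p)))" by simp
  moreover have "list_mean s (\<lambda>l. 1 - ?m l) \<le> exp 2 * (1 - q) ^ s"
    using list_mean_unspread_mass_le[OF x, of 1 W \<theta> s] W L W\<theta> by (simp add: q_def \<theta>_def)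
  ultimately have "list_mean s (\<lambda>l. 1 - ?m l) \<le> exp 2 * exp (- (s / (2 * t_ent n p)))" by linarith
  then have bad: "(1 / (2 * e) + 1) * list_mean s (\<lambda>l. 1 - ?m l)
      \<le> (1 / (2 * e) + 1) * (exp 2 * exp (- (s / (2 * t_ent n p))))"
    using e by (intro mult_left_mono) auto
  have "n * list_mean s ?S \<le> n * (1 / n + 1 / W)"
    using list_mean_spread_mass_square_le[OF x, of 1 W s] W by (intro mult_left_mono) auto
  also have "\<dots> = 1 + 1 / n" using N by (simp add: W_def field_simps power2_eq_square)
  finally have "(n * list_mean s ?S - 1) / (4 * e) \<le> 1 / n / (4 * e)"
    using e by (intro divide_right_mono) auto
  then have good: "(n * list_mean s ?S - 1) / (4 * e) \<le> 1 / (4 * e * n)" by (simp add: mult_ac)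
  have "list_mean s (\<lambda>l. tv_norm n (\<lambda>z. path_mass l x z - 1 / n))
      \<le> list_mean s (\<lambda>l. e / 4 + (n * ?S l - 1) / (4 * e) + (1 / (2 * e) + 1) * (1 - ?m l))"
    using x e by (intro list_mean_mono tv_norm_path_mass_le)
  also have "\<dots> = e / 4 + (n * list_mean s ?S - 1) / (4 * e) + (1 / (2 * e) + 1) * list_mean s (\<lambda>l. 1 - ?m l)"
    by (simp only: list_mean_add list_mean_cmult list_mean_divide list_mean_diff list_mean_const)
  finally show ?thesis using bad good by linarith
qed

lemma list_mean_cong:
  assumes "\<And>l. set l \<subseteq> Pow V \<Longrightarrow> f l = g l"
  shows "list_mean s f = list_mean s g"
  using assms by (intro order_antisym list_mean_mono) auto

text \<open>A Dirac mass has relative entropy \<open>ln n\<close>; what is left of it after the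
  expected losses must be paid for by total variation distance.\<close>

lemma list_mean_tv_norm_ge:
  assumes x: "x \<in> V"
  shows "ln n - s * mean_entropy_loss \<le> list_mean s (\<lambda>l. tv_norm n (\<lambda>z. path_mass l x z - 1 / n)) * (ln n + 1)"
proof -
  have "(\<Sum>z\<in>V. dirac_mass x z) = 1" "entropy_sum V (dirac_mass x) = 0"
    using x by (simp_all add: dirac_mass_def entropy_sum_def sum.neutral)
  then have "0 - s * mean_entropy_loss \<le> list_mean s (\<lambda>l. entropy_sum V (fold block_avg l (dirac_mass x)))"
    using list_mean_entropy_sum_ge[of "dirac_mass x" s] by (simp add: dirac_mass_def)
  also have "\<dots> = list_mean s (\<lambda>l. entropy_sum V (path_mass l x))"
    using x by (intro list_mean_cong) (simp add: entropy_sum_def fold_block_avg_dirac[OF finite_V])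
  also have "\<dots> \<le> list_mean s (\<lambda>l. (ln n + 1) * tv_norm n (\<lambda>z. path_mass l x z - 1 / n) - ln n)"
  proof (rule list_mean_mono)
    fix l assume "set l \<subseteq> Pow V"
    then show "entropy_sum V (path_mass l x) \<le> (ln n + 1) * tv_norm n (\<lambda>z. path_mass l x z - 1 / n) - ln n"
      using entropy_le_tv_norm[of n "path_mass l x"] sum_path_mass[OF finite_V _ x, of l] two_le_n
      by (simp add: V_def path_mass_nonneg mult.commute)
  qed
  also have "\<dots> = (ln n + 1) * list_mean s (\<lambda>l. tv_norm n (\<lambda>z. path_mass l x z - 1 / n)) - ln n"
    by (simp only: list_mean_diff list_mean_cmult list_mean_const)
  finally show ?thesis by (simp add: mult.commute)
qed

text \<open>Lets the rounding of \<open>c * t_ent\<close> to an integer be absorbed in the constant.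
  The lower bound on \<open>mean\<close> keeps the denominator of \<open>t_ent\<close> away from
  0.\<close>

lemma t_ent_ge_1: "1 \<le> t_ent n p"
proof -
  have L: "ln (real n) > 0" using two_le_n by auto
  have "mean (\<lambda>k. k * ln k) \<le> mean (\<lambda>k. n * ln n * 1)"
    by (intro mean_mono) (auto intro!: mult_mono)
  then have "mean (\<lambda>k. k * ln k) \<le> n * ln n" unfolding mean_cmult mean_1 by simp
  moreover have "mean (\<lambda>k. ln 2 * 1) \<le> mean (\<lambda>k. k * ln k)"
  proof (rule mean_mono)
    fix k :: nat assume "2 \<le> k"
    then have "1 * ln 2 \<le> k * ln k" by (intro mult_mono) auto
    then show "ln 2 * 1 \<le> k * ln k" by simp
  qed
  then have "0 < mean (\<lambda>k. k * ln k)" unfolding mean_cmult mean_1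
    using ln_gt_zero[of "2::real"] by linarith
  ultimately show ?thesis by (simp add: t_ent_def expectation_eq_mean)
qed

section \<open>The one-block law in terms of \<open>block_pmf\<close>\<close>

lemma prob_block_pmf:
  assumes "B \<subseteq> V"
  shows "measure_pmf.prob (block_pmf n p) (UNIV \<times> {B}) = weight B"
proof -
  let ?F = "\<lambda>k. {S. S \<subseteq> {1..n} \<and> card S = k}"
  have "map_pmf snd (block_pmf n p) = bind_pmf p (\<lambda>k. pmf_of_set (?F k))"
    by (simp add: block_pmf_def map_bind_pmf pmf.map_comp o_def)
  moreover have "snd -` {B} = UNIV \<times> {B}" by auto
  ultimately have "measure_pmf.prob (block_pmf n p) (UNIV \<times> {B}) = pmf (bind_pmf p (\<lambda>k. pmf_of_set (?F k))) B"
    by (metis pmf_map)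
  also have "\<dots> = mean (\<lambda>k. pmf (pmf_of_set (?F k)) B)" by (simp add: pmf_bind expectation_eq_mean)
  also have "\<dots> = mean (\<lambda>k. if k = card B then 1 / real (n choose card B) else 0)"
  proof (rule mean_cong)
    fix k assume k: "2 \<le> k" "k \<le> n"
    have c: "card (?F k) = n choose k" by (simp add: n_subsets)
    have fin: "finite (?F k)" by (rule finite_subset[of _ "Pow {1..n}"]) auto
    have "?F k \<noteq> {}" using c k by (metis card.empty zero_less_binomial_iff less_irrefl)
    then show "pmf (pmf_of_set (?F k)) B = (if k = card B then 1 / real (n choose card B) else 0)"
      using fin c assms by (auto simp: pmf_of_set indicator_def V_def)
  qed
  also have "\<dots> = (\<Sum>k\<in>{2..n}. if k = card B then weight B else 0)"
    unfolding mean_def weight_def by (intro sum.cong) auto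
  \<comment> \<open>If \<open>card B\<close> is outside \<open>{2..n}\<close> then no term survives,
    but then \<open>weight B\<close> is 0 too.\<close>
  also have "\<dots> = weight B"
    using weight_nonzeroD[OF _ assms] by (cases "weight B = 0") auto
  finally show ?thesis .
qed

end

section \<open>Mixing time\<close>

lemma eta_eq_fold: "eta A v t \<omega> = fold block_avg (map (\<lambda>i. A i \<omega>) [1..<Suc t]) v"
  by (induction t) auto

text \<open>The first \<open>t\<close> blocks form one of finitely many words, and by independence
  each word has the product of its weights as probability.\<close>

lemma (in block_average) expectation_eq_list_mean:
  assumes "2 \<le> n" "set_pmf p \<subseteq> {2..n}"
  shows "expectation (\<lambda>\<omega>. \<Phi> (map (\<lambda>i. A i \<omega>) [1..<Suc t])) = block_law.list_mean n p t \<Phi>"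
proof -
  interpret block_law n p using assms by unfold_locales
  let ?w = "\<lambda>\<omega>. map (\<lambda>i. A i \<omega>) [1..<Suc t]"
  let ?E = "\<lambda>l. {\<omega> \<in> space M. ?w \<omega> = l}"
  let ?XA = "\<lambda>i \<omega>. (X i \<omega>, A i \<omega>)"
  \<comment> \<open>Events of the pairs, since independence is given for these; the index is shifted
    because times start at 1 and list positions at 0.\<close>
  let ?C = "\<lambda>l i. ?XA i -` (UNIV \<times> {l ! (i - 1)}) \<inter> space M"
  have rv: "random_variable (count_space UNIV) (?XA i)" if "1 \<le> i" for i
    using indep that by (simp add: indep_vars_def2)
  have w_iff: "?w \<omega> = l \<longleftrightarrow> (\<forall>i\<in>{1..t}. A i \<omega> = l ! (i - 1))" if "length l = t" for \<omega> l
  proof -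
    have "?w \<omega> = l \<longleftrightarrow> (\<forall>i<t. A (Suc i) \<omega> = l ! i)"
      using that by (auto simp: list_eq_iff_nth_eq simp del: upt_Suc)
    also have "\<dots> \<longleftrightarrow> (\<forall>i\<in>{1..t}. A i \<omega> = l ! (i - 1))"
    proof (intro iffI ballI allI impI)
      fix i assume "\<forall>i<t. A (Suc i) \<omega> = l ! i" "i \<in> {1..t}"
      then show "A i \<omega> = l ! (i - 1)" by (cases i) auto
    next
      fix i assume "\<forall>i\<in>{1..t}. A i \<omega> = l ! (i - 1)" "i < t"
      then show "A (Suc i) \<omega> = l ! i" by (metis Suc_le_eq atLeastAtMost_iff diff_Suc_1 le_add1 plus_1_eq_Suc)
    qed
    finally show ?thesis .
  qed
  have C: "?C l i \<in> events" if "1 \<le> i" for l i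
    using rv[OF that] by (rule measurable_sets) simp
  have E: "?E l \<in> events \<and> prob (?E l) = prod_list (map weight l)" if l: "l \<in> words t" for l
  \<comment> \<open>An empty intersection would not be \<open>space M\<close>, and the product rule
    for independent events needs a nonempty index set.\<close>
  proof (cases "t = 0")
    case True
    then have "?E l = space M" "l = []" using l by (auto simp: words_def)
    then show ?thesis by (simp add: prob_space)
  next
    case False
    have len: "length l = t" using l by (simp add: words_def)
    have "?E l = {\<omega> \<in> space M. \<forall>i\<in>{1..t}. A i \<omega> = l ! (i - 1)}" by (simp only: w_iff[OF len])
    also have "\<dots> = (\<Inter>i\<in>{1..t}. ?C l i)" using False by auto
    finally have eq: "?E l = (\<Inter>i\<in>{1..t}. ?C l i)" .
    have "prob (\<Inter>i\<in>{1..t}. ?C l i) = (\<Prod>i\<in>{1..t}. prob (?C l i))"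
      using indep False unfolding indep_vars_def2 by (intro indep_setsD) auto
    also have "\<dots> = (\<Prod>i\<in>{1..t}. weight (l ! (i - 1)))"
    proof (intro prod.cong refl)
      fix i assume i: "i \<in> {1..t}"
      have "l ! (i - 1) \<in> set l" using i len by (intro nth_mem) auto
      then have B: "l ! (i - 1) \<subseteq> V" using l by (auto simp: words_def)
      have "prob (?C l i) = measure (distr M (count_space UNIV) (?XA i)) (UNIV \<times> {l ! (i - 1)})"
        using rv[of i] i by (subst measure_distr) auto
      also have "\<dots> = weight (l ! (i - 1))"
        using law[of i] i B by (simp add: prob_block_pmf)
      finally show "prob (?C l i) = weight (l ! (i - 1))" .
    qed
    also have "\<dots> = (\<Prod>i<t. weight (l ! i))"
      by (rule prod.reindex_bij_witness[of _ Suc "\<lambda>i. i - 1"]) auto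
    also have "\<dots> = prod_list (map weight l)"
      using len by (simp add: prod.list_conv_set_nth atLeast0LessThan)
    finally have "prob (\<Inter>i\<in>{1..t}. ?C l i) = prod_list (map weight l)" .
    moreover have "(\<Inter>i\<in>{1..t}. ?C l i) \<in> events" using False by (intro sets.finite_INT C) auto
    ultimately show ?thesis unfolding eq by blast
  qed
  \<comment> \<open>Pointwise on \<open>space M\<close>, exactly one indicator is 1, because there
    all blocks lie in \<open>V\<close>.\<close>
  have "expectation (\<lambda>\<omega>. \<Phi> (?w \<omega>)) = expectation (\<lambda>\<omega>. \<Sum>l\<in>words t. \<Phi> l * indicator (?E l) \<omega>)"
  proof (rule Bochner_Integration.integral_cong)
    fix \<omega> assume \<omega>: "\<omega> \<in> space M"
    have "A i \<omega> \<subseteq> V" if "1 \<le> i" for i using block_subset[OF that \<omega>] by (simp add: V_def)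
    then have "?w \<omega> \<in> words t" by (simp add: words_def image_subset_iff del: upt_Suc)
    have "(\<Sum>l\<in>words t. \<Phi> l * indicator (?E l) \<omega>) = (\<Sum>l\<in>words t. if l = ?w \<omega> then \<Phi> l else 0)"
      using \<omega> by (intro sum.cong) (auto simp: indicator_def)
    also have "\<dots> = \<Phi> (?w \<omega>)" using \<open>?w \<omega> \<in> words t\<close> finite_words by simp
    finally show "\<Phi> (?w \<omega>) = (\<Sum>l\<in>words t. \<Phi> l * indicator (?E l) \<omega>)" ..
  qed simp
  also have "\<dots> = (\<Sum>l\<in>words t. \<Phi> l * prob (?E l))"
    using E by (subst Bochner_Integration.integral_sum) (auto simp: emeasure_eq_measure)
  also have "\<dots> = list_mean t \<Phi>" unfolding list_mean_def using E by (intro sum.cong) auto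
  finally show ?thesis .
qed

lemma (in block_average) expectation_d_TV:
  assumes n: "2 \<le> n" and p: "set_pmf p \<subseteq> {2..n}" and x: "x \<in> {1..n}"
  shows "expectation (d_TV n A x t) =
    block_law.list_mean n p t (\<lambda>l. tv_norm n (\<lambda>z. path_mass l x z - 1 / n))"
proof -
  interpret block_law n p using n p by unfold_locales
  have "expectation (d_TV n A x t) =
      list_mean t (\<lambda>l. tv_norm n (\<lambda>z. fold block_avg l (dirac_mass x) z - 1 / n))"
    unfolding d_TV_def eta_eq_fold by (rule expectation_eq_list_mean[OF n p])
  also have "\<dots> = list_mean t (\<lambda>l. tv_norm n (\<lambda>z. path_mass l x z - 1 / n))"
    using x unfolding tv_norm_def V_def[symmetric]
    by (intro list_mean_cong arg_cong2[where f = "(*)"] refl sum.cong) (simp add: fold_block_avg_dirac[OF finite_V])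
  finally show ?thesis .
qed

text \<open>The upper bound exhibits a time near \<open>c * t_ent\<close> at which the distance is
  below \<epsilon>; the lower bound applies the entropy estimate at the mixing time itself.\<close>

lemma (in block_average) t_mix_bounds:
  assumes n: "2 \<le> n" and p: "set_pmf p \<subseteq> {2..n}" and x: "x \<in> {1..n}"
    and e: "0 < \<epsilon>" "\<epsilon> < 1"
    and n_large: "2 / \<epsilon>\<^sup>2 \<le> real n" "2 * \<epsilon> / (1 - \<epsilon>) \<le> ln (real n)"
    and c: "(1 / (2 * \<epsilon>) + 1) * (exp 2 * exp (- (c / 2))) \<le> \<epsilon> / 4" "0 \<le> c"
  obtains t where "t_mix M n A x \<epsilon> = enat t"
    "real t \<le> (c + 1) * t_ent n p" "(1 - \<epsilon>) / 2 * t_ent n p \<le> real t"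
proof -
  interpret block_law n p using n p by unfold_locales
  have xV: "x \<in> V" using x by (simp add: V_def)
  note d = expectation_d_TV[OF n p x]
  let ?T = "t_ent n p" and ?S = "{t. expectation (d_TV n A x t) < \<epsilon>}"
  have L: "ln (real n) > 0" using n by auto
  have T: "1 \<le> ?T" by (rule t_ent_ge_1)
  define s where "s = nat \<lceil>c * ?T\<rceil>"
  have cT: "0 \<le> c * ?T" using c T by simp
  have s: "c * ?T \<le> s" "s \<le> c * ?T + 1" unfolding s_def using cT by linarith+
  have "s \<in> ?S"
  proof -
    have "c / 2 \<le> s / (2 * ?T)" using s T by (simp add: field_simps)
    then have "(1 / (2 * \<epsilon>) + 1) * (exp 2 * exp (- (s / (2 * ?T)))) \<le> (1 / (2 * \<epsilon>) + 1) * (exp 2 * exp (- (c / 2)))"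
      using e by (intro mult_left_mono) auto
    also have "\<dots> \<le> \<epsilon> / 4" by (rule c)
    finally have 1: "(1 / (2 * \<epsilon>) + 1) * (exp 2 * exp (- (s / (2 * ?T)))) \<le> \<epsilon> / 4" .
    have 2: "1 / (4 * \<epsilon> * n) \<le> \<epsilon> / 8"
      using n_large(1) e n by (simp add: field_simps power2_eq_square)
    \<comment> \<open>The three terms are at most a quarter, an eighth and a quarter of \<epsilon>,
      hence sum to less than \<epsilon>.\<close>
    show ?thesis using list_mean_tv_norm_le[OF xV e(1), of s] 1 2 e by (simp add: d)
  qed
  then have "t_mix M n A x \<epsilon> \<le> enat s" unfolding t_mix_def by (rule INF_lower)
  \<comment> \<open>The infimum of a nonempty set in a well-order is attained, so the mixing time
    itself satisfies the defining inequality.\<close>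
  moreover have "t_mix M n A x \<epsilon> \<in> enat ` ?S"
    unfolding t_mix_def using \<open>s \<in> ?S\<close> by (intro wellorder_InfI[of "enat s"] imageI)
  ultimately obtain t where t: "t_mix M n A x \<epsilon> = enat t" "t \<in> ?S" "t \<le> s" by auto
  have "ln n - t * mean_entropy_loss \<le> \<epsilon> * (ln n + 1)"
    using list_mean_tv_norm_ge[OF xV, of t] t(2) L
    by (intro order_trans[OF list_mean_tv_norm_ge[OF xV, of t]] mult_right_mono) (auto simp: d)
  \<comment> \<open>Half of \<open>(1 - \<epsilon>) * ln n\<close> absorbs the additive \<epsilon>;
    the other half gives the constant \<open>(1 - \<epsilon>) / 2\<close>.\<close>
  moreover have "\<epsilon> \<le> (1 - \<epsilon>) / 2 * ln n" using n_large(2) e by (simp add: field_simps)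
  ultimately have "(1 - \<epsilon>) / 2 * ln n \<le> t * mean_entropy_loss" by (simp add: field_simps)
  moreover have T_eq: "?T = ln n / mean_entropy_loss"
    by (simp add: t_ent_def mean_entropy_loss_def expectation_eq_mean)
  moreover have "mean_entropy_loss > 0"
    using T L unfolding T_eq by (metis divide_le_0_iff less_le_trans linorder_not_le not_one_le_zero less_imp_le)
  ultimately have "(1 - \<epsilon>) / 2 * ln n / mean_entropy_loss \<le> t" by (simp add: pos_divide_le_eq)
  then have "(1 - \<epsilon>) / 2 * ?T \<le> t" by (simp add: T_eq)
  moreover have "real t \<le> (c + 1) * ?T" using t(3) s(2) T by (simp add: algebra_simps)
  ultimately show ?thesis using that t(1) by blast
qed

theorem theorem2p5:
  fixes M :: "nat \<Rightarrow> 'a measure"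
    and p :: "nat \<Rightarrow> nat pmf"
    and X :: "nat \<Rightarrow> nat \<Rightarrow> 'a \<Rightarrow> nat"
    and A :: "nat \<Rightarrow> nat \<Rightarrow> 'a \<Rightarrow> nat set"
    and x0 :: "nat \<Rightarrow> nat"
    and \<epsilon> :: real
  assumes "\<And>n. n \<ge> 2 \<Longrightarrow> set_pmf (p n) \<subseteq> {2..n}"
    and "\<And>n. n \<ge> 2 \<Longrightarrow> block_average (M n) n (p n) (X n) (A n)"
    and "\<And>n. n \<ge> 2 \<Longrightarrow> x0 n \<in> {1..n}"
    and "0 < \<epsilon>" and "\<epsilon> < 1"
  shows "\<exists>C::real. \<forall>\<^sub>F n in sequentially.
    ereal_of_enat (t_mix (M n) n (A n) (x0 n) \<epsilon>) / ereal (t_ent n (p n)) \<le> ereal C \<and>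
    ereal (t_ent n (p n)) / ereal_of_enat (t_mix (M n) n (A n) (x0 n) \<epsilon>) \<le> ereal C"
proof -
  define b where "b = (1 / (2 * \<epsilon>) + 1) * exp 2"
  have b: "b > 0" using assms(4) by (simp add: b_def add_pos_pos)
  \<comment> \<open>Chosen so that \<open>b * exp (- (c / 2))\<close> is at most a quarter of
    \<epsilon>; it depends on \<epsilon> only, not on \<open>n\<close> or the laws.\<close>
  define c where "c = max 0 (2 * ln (4 * b / \<epsilon>))"
  have "exp (- (c / 2)) \<le> exp (- ln (4 * b / \<epsilon>))" by (simp add: c_def)
  also have "\<dots> = \<epsilon> / (4 * b)" using b assms(4) by (simp add: exp_minus)
  finally have "b * exp (- (c / 2)) \<le> \<epsilon> / 4" using b by (simp add: field_simps)
  then have c: "(1 / (2 * \<epsilon>) + 1) * (exp 2 * exp (- (c / 2))) \<le> \<epsilon> / 4" by (simp add: b_def mult.assoc)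
  define C where "C = max (c + 1) (2 / (1 - \<epsilon>))"
  have "\<forall>\<^sub>F n in sequentially. 2 \<le> n" by (rule eventually_ge_at_top)
  moreover have "\<forall>\<^sub>F n in sequentially. 2 / \<epsilon>\<^sup>2 \<le> real n"
    using filterlim_real_sequentially by (simp add: filterlim_at_top)
  moreover have "\<forall>\<^sub>F n in sequentially. 2 * \<epsilon> / (1 - \<epsilon>) \<le> ln (real n)"
    using filterlim_compose[OF ln_at_top filterlim_real_sequentially] by (simp add: filterlim_at_top)
  ultimately have "\<forall>\<^sub>F n in sequentially.
    ereal_of_enat (t_mix (M n) n (A n) (x0 n) \<epsilon>) / ereal (t_ent n (p n)) \<le> ereal C \<and>
    ereal (t_ent n (p n)) / ereal_of_enat (t_mix (M n) n (A n) (x0 n) \<epsilon>) \<le> ereal C"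
  proof eventually_elim
    case (elim n)
    interpret block_average "M n" n "p n" "X n" "A n" using assms(2) elim(1) .
    obtain t where t: "t_mix (M n) n (A n) (x0 n) \<epsilon> = enat t"
      "real t \<le> (c + 1) * t_ent n (p n)" "(1 - \<epsilon>) / 2 * t_ent n (p n) \<le> real t"
      using t_mix_bounds[OF elim(1) assms(1)[OF elim(1)] assms(3)[OF elim(1)] assms(4,5) elim(2,3) c]
      by (auto simp: c_def)
    have T: "1 \<le> t_ent n (p n)"
      using block_law.t_ent_ge_1[of n "p n"] assms(1) elim(1) by (simp add: block_law_def)
    have "0 < (1 - \<epsilon>) / 2 * t_ent n (p n)" using T assms(5) by simp
    \<comment> \<open>Positivity of the mixing time makes the second ratio an ordinary real
      quotient.\<close>
    then have t0: "real t > 0" using t(3) by linarith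
    have "real t / t_ent n (p n) \<le> c + 1" using t(2) T by (simp add: field_simps)
    moreover have "t_ent n (p n) / real t \<le> 2 / (1 - \<epsilon>)" using t(3) t0 assms(5) by (simp add: field_simps)
    ultimately show ?case using t(1) T t0 by (simp add: C_def le_max_iff_disj)
  qed
  then show ?thesis by blast
qed

end
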